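(* Let $k\ge2$, let $H$ be a $k$-uniform partial cube-hypergraph, and let $F_1,\dots,F_m$ be the equivalence classes of the relation $\Theta$ on $E(H)$. For each $i\in[m]$, the hypergraph $H-F_i$ has exactly $k$ connected components $H_1(F_i),\dots,H_k(F_i)$; let $n_j(F_i)=|V(H_j(F_i))|$ for $j\in[k]$. Then $$W(H)=\sum_{i=1}^m\ \sum_{\{j,j'\}\in\binom{[k]}{2}} n_j(F_i)\cdot n_{j'}(F_i).$$
   Context: A hypergraph $H=(V(H),E(H))$ has edges that are non-empty subsets of $V(H)$; it is $k$-uniform if every edge has exactly $k$ vertices. A $u,v$-path of length $s\ge1$ is a sequence $u_0=u,e_1,u_1,\dots,e_s,u_s=v$ of pairwise distinct vertices $u_i$ and pairwise distinct edges $e_i$ with $\{u_{i-1},u_i\}\subseteq e_i$; $d_H(u,v)$ is the length of a shortest $u,v$-path ($d_H(u,u)=0$). The Wiener index is $W(H)=\sum_{\{u,v\}\in\binom{V(H)}{2}} d_H(u,v)$. A subhypergraph $H'$ of $H$ is isometric if $d_{H'}(u,v)=d_H(u,v)$ for all $u,v\in V(H')$. For $k\ge2$, $n\ge1$, the $k$-uniform $n$-cube $\mathcal{Q}_k^n$ has vertex set $\{0,1,\dots,k-1\}^n$, and its edges are exactly the sets consisting of all $n$-tuples that agree on a fixed set of $n-1$ coordinates (with fixed values) while the remaining coordinate ranges over $\{0,\dots,k-1\}$. A $k$-uniform hypergraph is a partial cube-hypergraph if it is an isometric subhypergraph of some $\mathcal{Q}_k^n$. For an edge $e=\{a_1,\dots,a_k\}$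 let $H(a_i,e)=\{z\in V(H): d_H(z,a_i)<d_H(z,a_j)\text{ for all } j\ne i\}$ and $H_e=\{H(a_1,e),\dots,H(a_k,e)\}$. The relation $\Theta$ on $E(H)$ is defined by $e\,\Theta\, e'$ iff $e'\cap A\neq\emptyset$ for every $A\in H_e$; on a partial cube-hypergraph it is an equivalence relation. For $F\subseteq E(H)$, $H-F$ is the hypergraph with vertex set $V(H)$ and edge set $E(H)\setminus F$. $[k]=\{1,\dots,k\}$. *)

theory Defs
  imports Main "HOL-Library.Extended_Nat"
begin

datatype 'a hypergraph = Hypergraph (verts: "'a set") (edges: "'a set set")

definition hypergraph :: "'a hypergraph \<Rightarrow> bool" where
  "hypergraph H \<longleftrightarrow> (\<forall>e \<in> edges H. e \<noteq> {} \<and> e \<subseteq> verts H)"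

definition uniform :: "nat \<Rightarrow> 'a hypergraph \<Rightarrow> bool" where
  "uniform k H \<longleftrightarrow> hypergraph H \<and> (\<forall>e \<in> edges H. card e = k)"

text \<open>The vertices and the edges of a path are listed separately: \<open>us = [u\<^sub>0, ..., u\<^sub>s]\<close> and
  \<open>es = [e\<^sub>1, ..., e\<^sub>s]\<close>, so that \<open>e\<^sub>i\<close> is \<open>es ! (i - 1)\<close>.\<close>

definition is_path :: "'a hypergraph \<Rightarrow> 'a \<Rightarrow> 'a \<Rightarrow> 'a list \<Rightarrow> 'a set list \<Rightarrow> bool" where
  "is_path H u v us es \<longleftrightarrow>
     length es \<ge> 1 \<and> length us = length es + 1 \<and>
     set us \<subseteq> verts H \<and> set es \<subseteq> edges H \<and> distinct us \<and> distinct es \<and>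
     us ! 0 = u \<and> us ! length es = v \<and>
     (\<forall>i < length es. {us ! i, us ! Suc i} \<subseteq> es ! i)"

text \<open>The distance is infinite if there is no path (the infimum of the empty set).\<close>

definition hdist :: "'a hypergraph \<Rightarrow> 'a \<Rightarrow> 'a \<Rightarrow> enat" where
  "hdist H u v = (if u = v then 0 else Inf {enat (length es) | us es. is_path H u v us es})"

text \<open>The summand is the distance of the two elements of the unordered pair \<open>P\<close>; it is well
  defined by symmetry, see \<open>hdist_pair\<close> below.\<close>

definition wiener :: "'a hypergraph \<Rightarrow> enat" where
  "wiener H = (\<Sum>P | P \<subseteq> verts H \<and> card P = 2. THE d. \<exists>u v. P = {u, v} \<and> d = hdist H u v)"

lemma is_path_rev:
  assumes "is_path H u v us es"
  shows "is_path H v u (rev us) (rev es)"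
proof -
  have "{rev us ! i, rev us ! Suc i} \<subseteq> rev es ! i" if i: "i < length es" for i
  proof -
    define j where "j = length es - Suc i"
    have j: "j < length es" "length es - i = Suc j" using i by (auto simp: j_def)
    have "{us ! j, us ! Suc j} \<subseteq> es ! j" using assms j by (auto simp: is_path_def)
    moreover have "rev us ! i = us ! Suc j" "rev us ! Suc i = us ! j" "rev es ! i = es ! j"
      using assms i j by (auto simp: is_path_def rev_nth j_def)
    ultimately show ?thesis by auto
  qed
  then show ?thesis
    using assms by (auto simp: is_path_def rev_nth)
qed

lemma hdist_commute: "hdist H u v = hdist H v u"
proof -
  have "{enat (length es) | us es. is_path H u v us es} \<subseteq>
        {enat (length es) | us es. is_path H v u us es}" for u v
  proof
    fix d assume "d \<in> {enat (length es) | us es. is_path H u v us es}"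
    then obtain us es where d: "d = enat (length es)" and p: "is_path H u v us es" by blast
    have "d = enat (length (rev es))" using d by simp
    with is_path_rev[OF p] show "d \<in> {enat (length es) | us es. is_path H v u us es}" by blast
  qed
  then have "{enat (length es) | us es. is_path H u v us es} =
             {enat (length es) | us es. is_path H v u us es}"
    by (simp add: subset_antisym)
  then show ?thesis by (simp add: hdist_def)
qed

lemma hdist_pair: "(THE d. \<exists>x y. {u, v} = {x, y} \<and> d = hdist H x y) = hdist H u v"
  by (rule the_equality) (auto simp: doubleton_eq_iff hdist_commute)

definition subhypergraph :: "'a hypergraph \<Rightarrow> 'a hypergraph \<Rightarrow> bool" where
  "subhypergraph H' H \<longleftrightarrow> hypergraph H' \<and> verts H' \<subseteq> verts H \<and> edges H' \<subseteq> edges H"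

definition isometric_subhypergraph :: "'a hypergraph \<Rightarrow> 'a hypergraph \<Rightarrow> bool" where
  "isometric_subhypergraph H' H \<longleftrightarrow>
     subhypergraph H' H \<and> (\<forall>u \<in> verts H'. \<forall>v \<in> verts H'. hdist H' u v = hdist H u v)"

definition isomorphic :: "'a hypergraph \<Rightarrow> 'b hypergraph \<Rightarrow> bool" where
  "isomorphic H H' \<longleftrightarrow>
     (\<exists>f. bij_betw f (verts H) (verts H') \<and> edges H' = (\<lambda>e. f ` e) ` edges H)"

definition cube_verts :: "nat \<Rightarrow> nat \<Rightarrow> nat list set" where
  "cube_verts k n = {x. length x = n \<and> set x \<subseteq> {..<k}}"

definition cube :: "nat \<Rightarrow> nat \<Rightarrow> nat list hypergraph" where
  "cube k n = Hypergraph (cube_verts k n)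
     {{y \<in> cube_verts k n. \<forall>j < n. j \<noteq> i \<longrightarrow> y ! j = x ! j} | x i. x \<in> cube_verts k n \<and> i < n}"

text \<open>As usual for partial cubes, being an isometric subhypergraph of a cube is understood up to
  isomorphism, so that the vertices of \<open>H\<close> need not be tuples themselves.\<close>

definition partial_cube_hypergraph :: "nat \<Rightarrow> 'a hypergraph \<Rightarrow> bool" where
  "partial_cube_hypergraph k H \<longleftrightarrow>
     uniform k H \<and>
     (\<exists>n \<ge> 1. \<exists>H'. isometric_subhypergraph H' (cube k n) \<and> isomorphic H H')"

definition closer :: "'a hypergraph \<Rightarrow> 'a \<Rightarrow> 'a set \<Rightarrow> 'a set" where
  "closer H a e = {z \<in> verts H. \<forall>b \<in> e - {a}. hdist H z a < hdist H z b}"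

definition Theta :: "'a hypergraph \<Rightarrow> ('a set \<times> 'a set) set" where
  "Theta H = {(e, e'). e \<in> edges H \<and> e' \<in> edges H \<and>
                       (\<forall>A \<in> {closer H a e | a. a \<in> e}. e' \<inter> A \<noteq> {})}"

definition delete_edges :: "'a hypergraph \<Rightarrow> 'a set set \<Rightarrow> 'a hypergraph" where
  "delete_edges H F = Hypergraph (verts H) (edges H - F)"

definition component_of :: "'a hypergraph \<Rightarrow> 'a \<Rightarrow> 'a hypergraph" where
  "component_of H u =
     (let C = {v \<in> verts H. v = u \<or> (\<exists>us es. is_path H u v us es)}
      in Hypergraph C {e \<in> edges H. e \<subseteq> C})"

definition components :: "'a hypergraph \<Rightarrow> 'a hypergraph set" where
  "components H = component_of H ` verts H"

end

theory Submission
  imports Defs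
begin

text \<open>Embed \<open>H\<close> isometrically in a cube, so that distances in \<open>H\<close> are Hamming distances. Every edge
  varies exactly one coordinate, its direction, and two edges are related by \<open>\<Theta>\<close> iff they have the
  same direction. Deleting the edges of direction \<open>i\<close> separates exactly the vertices that differ
  in coordinate \<open>i\<close>, since a geodesic between vertices that agree there never changes that
  coordinate. So the distance of two vertices is the number of classes whose deletion separates them,
  and counting separated pairs class by class gives the formula.\<close>

section \<open>Distances and reachability\<close>

text \<open>Powers of this relation are walks, which may repeat vertices and edges and therefore
  suit induction better than paths.\<close>

definition adj :: "'a hypergraph \<Rightarrow> ('a \<times> 'a) set" where
  "adj H = {(x, y). \<exists>e \<in> edges H. x \<in> e \<and> y \<in> e}"

lemma is_path_relpow:
  assumes "is_path H u v us es"
  shows "(u, v) \<in> adj H ^^ length es"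
  unfolding relpow_fun_conv
proof (intro exI conjI allI impI)
  show "us ! 0 = u" "us ! length es = v" using assms by (auto simp: is_path_def)
  fix i assume "i < length es"
  then have "es ! i \<in> edges H" "{us ! i, us ! Suc i} \<subseteq> es ! i"
    using assms by (auto simp: is_path_def)
  then show "(us ! i, us ! Suc i) \<in> adj H" by (auto simp: adj_def)
qed

text \<open>A walk of minimal length repeats neither a vertex nor an edge, since a repetition would allow a
  shortcut.\<close>

lemma relpow_is_path:
  assumes H: "hypergraph H" and ne: "u \<noteq> v" and m: "(u, v) \<in> adj H ^^ m"
  shows "\<exists>us es. is_path H u v us es \<and> length es \<le> m"
proof -
  define s where "s = (LEAST s. (u, v) \<in> adj H ^^ s)"
  have s: "(u, v) \<in> adj H ^^ s" unfolding s_def using m by (rule LeastI)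
  have least: "s \<le> t" if "(u, v) \<in> adj H ^^ t" for t
    unfolding s_def using that by (rule Least_le)
  from s obtain f where f0: "f 0 = u" and fs: "f s = v"
    and fa: "\<And>i. i < s \<Longrightarrow> (f i, f (Suc i)) \<in> adj H"
    unfolding relpow_fun_conv by blast
  have "\<forall>i. \<exists>e. i < s \<longrightarrow> e \<in> edges H \<and> f i \<in> e \<and> f (Suc i) \<in> e"
    using fa by (auto simp: adj_def)
  then obtain g where g: "\<And>i. i < s \<Longrightarrow> g i \<in> edges H \<and> f i \<in> g i \<and> f (Suc i) \<in> g i"
    by metis
  have pre: "(u, f i) \<in> adj H ^^ i" if "i \<le> s" for i
    unfolding relpow_fun_conv using that f0 fa by (intro exI[of _ f]) auto
  have suf: "(f i, v) \<in> adj H ^^ (s - i)" if "i \<le> s" for i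
    unfolding relpow_fun_conv using that fs fa by (intro exI[of _ "\<lambda>j. f (i + j)"]) auto
  have f_ne: "f i \<noteq> f j" if "i < j" "j \<le> s" for i j
  proof
    assume "f i = f j"
    then have "(u, v) \<in> adj H ^^ i O adj H ^^ (s - j)"
      using pre[of i] suf[of j] that by auto
    then have "s \<le> i + (s - j)" by (intro least) (simp add: relpow_add)
    with that show False by linarith
  qed
  have g_ne: "g i \<noteq> g j" if "i < j" "j < s" for i j
  proof
    assume eq: "g i = g j"
    \<comment> \<open>A common edge of steps \<open>i\<close> and \<open>j\<close> contains both
      \<open>f i\<close> and \<open>f (Suc j)\<close>, so a single step replaces
      \<open>j - i + 1\<close> of them.\<close>
    have "(f i, f (Suc j)) \<in> adj H"
      using g[of i] g[of j] that eq by (auto simp: adj_def)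
    moreover have "(u, f i) \<in> adj H ^^ i" "(f (Suc j), v) \<in> adj H ^^ (s - Suc j)"
      using pre[of i] suf[of "Suc j"] that by auto
    ultimately have "(u, v) \<in> adj H ^^ Suc i O adj H ^^ (s - Suc j)"
      by auto
    then have "s \<le> Suc i + (s - Suc j)" by (intro least) (simp only: relpow_add)
    with that show False by linarith
  qed
  \<comment> \<open>Positivity gives the minimal path length 1 and an edge \<open>g (s - 1)\<close>
    that contains the last vertex.\<close>
  have s_pos: "s > 0" using f0 fs ne by (cases s) auto
  have f_verts: "f i \<in> verts H" if "i \<le> s" for i
  proof (cases "i = s")
    case True
    then show ?thesis using g[of "s - 1"] s_pos H by (auto simp: hypergraph_def)
  next
    case False
    then show ?thesis using g[of i] that H by (auto simp: hypergraph_def)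
  qed
  have inj_f: "inj_on f {0..<Suc s}"
    by (rule linorder_inj_onI) (auto dest: f_ne)
  have inj_g: "inj_on g {0..<s}"
    by (rule linorder_inj_onI) (auto dest: g_ne)
  have "is_path H u v (map f [0..<Suc s]) (map g [0..<s])"
    unfolding is_path_def
  proof (intro conjI allI impI)
    fix i assume "i < length (map g [0..<s])"
    then show "{map f [0..<Suc s] ! i, map f [0..<Suc s] ! Suc i} \<subseteq> map g [0..<s] ! i"
      using g[of i] by (simp del: upt_Suc)
  qed (use s_pos f_verts g f0 fs inj_f inj_g in
        \<open>auto simp: distinct_map simp del: upt_Suc\<close>)
  moreover have "length (map g [0..<s]) \<le> m" using least[OF m] by simp
  ultimately show ?thesis by blast
qed

text \<open>Every path is a walk, and a walk between distinct vertices can be shortened to a path.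
  Infinite distance lies below no finite threshold.\<close>

lemma hdist_le_iff:
  assumes H: "hypergraph H"
  shows "hdist H u v \<le> enat m \<longleftrightarrow> (\<exists>s \<le> m. (u, v) \<in> adj H ^^ s)"
proof (cases "u = v")
  case True
  then show ?thesis by (auto simp: hdist_def zero_enat_def intro!: exI[of _ 0])
next
  case False
  let ?S = "{enat (length es) | us es. is_path H u v us es}"
  have "hdist H u v \<le> enat m \<longleftrightarrow> (\<exists>us es. is_path H u v us es \<and> length es \<le> m)"
  proof
    assume le: "hdist H u v \<le> enat m"
    \<comment> \<open>Without a path the infimum would be infinite; a nonempty set of
      \<open>enat\<close> attains its infimum.\<close>
    have "?S \<noteq> {}"
    proof
      assume "?S = {}"
      then have "hdist H u v = Inf {}" using False by (simp only: hdist_def if_False)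
      with le show False by (simp add: top_enat_def)
    qed
    then have "Inf ?S \<in> ?S" by (meson ex_in_conv wellorder_InfI)
    then show "\<exists>us es. is_path H u v us es \<and> length es \<le> m"
      using le False by (fastforce simp: hdist_def)
  next
    assume "\<exists>us es. is_path H u v us es \<and> length es \<le> m"
    then obtain us es where p: "is_path H u v us es" and l: "length es \<le> m" by blast
    have "Inf ?S \<le> enat (length es)" by (rule Inf_lower) (use p in blast)
    then show "hdist H u v \<le> enat m"
      using l False by (auto simp: hdist_def intro: order_trans)
  qed
  also have "\<dots> \<longleftrightarrow> (\<exists>s \<le> m. (u, v) \<in> adj H ^^ s)"
    using is_path_relpow relpow_is_path[OF H False] order_trans by metis
  finally show ?thesis .
qed

text \<open>The disjunct \<open>v = u\<close> accounts for the empty walk, as paths have length at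
  least 1.\<close>

lemma ex_is_path_iff:
  assumes "hypergraph H"
  shows "v = u \<or> (\<exists>us es. is_path H u v us es) \<longleftrightarrow> (u, v) \<in> (adj H)\<^sup>*"
  using is_path_relpow[of H u v] relpow_is_path[OF assms, of u v]
  by (metis rtrancl.rtrancl_refl rtrancl_power)

text \<open>Finite thresholds also detect infinity, so equality of distances reduces to
  \<open>hdist_le_iff\<close> without a case split on finiteness.\<close>

lemma enat_eqI_le:
  fixes x y :: enat
  assumes "\<And>m. x \<le> enat m \<longleftrightarrow> y \<le> enat m"
  shows "x = y"
  by (metis assms enat.exhaust enat_ord_code(3) enat_ord_simps(5) linorder_neq_iff
      dual_order.refl order.antisym)

lemma relpow_adj_image:
  assumes "\<And>e. e \<in> edges H \<Longrightarrow> f ` e \<in> edges H'" and "(u, v) \<in> adj H ^^ m"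
  shows "(f u, f v) \<in> adj H' ^^ m"
  using assms(2)
proof (induction m arbitrary: v)
  case (Suc m)
  then obtain w where w: "(u, w) \<in> adj H ^^ m" "(w, v) \<in> adj H" by auto
  have "(f w, f v) \<in> adj H'" using w(2) assms(1) unfolding adj_def by blast
  then show ?case using Suc.IH[OF w(1)] by auto
qed simp

lemma hdist_isomorphism:
  assumes H: "hypergraph H" and H': "hypergraph H'"
    and bij: "bij_betw f (verts H) (verts H')" and ed: "edges H' = (\<lambda>e. f ` e) ` edges H"
    and uv: "u \<in> verts H" "v \<in> verts H"
  shows "hdist H u v = hdist H' (f u) (f v)"
proof -
  let ?g = "inv_into (verts H) f"
  have inj: "inj_on f (verts H)" using bij by (simp add: bij_betw_def)
  have inv_edge: "?g ` e \<in> edges H" if "e \<in> edges H'" for e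
  proof -
    from that ed obtain e0 where e0: "e0 \<in> edges H" "e = f ` e0" by auto
    then have "e0 \<subseteq> verts H" using H by (auto simp: hypergraph_def)
    then show ?thesis using e0 inj by (simp add: inv_into_image_cancel)
  qed
  \<comment> \<open>Walks are carried forward by \<open>f\<close> and back by its inverse on the
    vertices.\<close>
  have "(u, v) \<in> adj H ^^ s \<longleftrightarrow> (f u, f v) \<in> adj H' ^^ s" for s
    using relpow_adj_image[of H f H' u v s] relpow_adj_image[of H' ?g H "f u" "f v" s] ed inv_edge inj uv
    by auto
  then show ?thesis
    by (intro enat_eqI_le) (simp add: hdist_le_iff[OF H] hdist_le_iff[OF H'])
qed

section \<open>The cube\<close>

lemma hypergraph_cube: "hypergraph (cube k n)"
  by (auto simp: hypergraph_def cube_def)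

lemma finite_cube_verts: "finite (cube_verts k n)"
  using finite_lists_length_eq[of "{..<k}" n] by (simp add: cube_verts_def conj_commute)

lemma cube_verts_nth: "x \<in> cube_verts k n \<Longrightarrow> i < n \<Longrightarrow> x ! i < k"
  by (metis (mono_tags, lifting) cube_verts_def lessThan_iff mem_Collect_eq nth_mem subsetD)

lemma cube_verts_update:
  "x \<in> cube_verts k n \<Longrightarrow> a < k \<Longrightarrow> x[i := a] \<in> cube_verts k n"
  by (auto simp: cube_verts_def dest: set_update_subset_insert[THEN subsetD])

lemma cube_edgeE:
  assumes "e \<in> edges (cube k n)"
  obtains i where "i < n" "\<And>x y j. x \<in> e \<Longrightarrow> y \<in> e \<Longrightarrow> j < n \<Longrightarrow> j \<noteq> i \<Longrightarrow> x ! j = y ! j"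
    "bij_betw (\<lambda>x. x ! i) e {..<k}"
proof -
  from assms obtain x i where x: "x \<in> cube_verts k n" and i: "i < n"
    and e: "e = {y \<in> cube_verts k n. \<forall>j < n. j \<noteq> i \<longrightarrow> y ! j = x ! j}"
    by (auto simp: cube_def)
  have "bij_betw (\<lambda>x. x ! i) e {..<k}"
  \<comment> \<open>Overwriting coordinate \<open>i\<close> of the base point \<open>x\<close>
    inverts reading that coordinate off.\<close>
  proof (rule bij_betw_byWitness[where f' = "\<lambda>a. x[i := a]"])
    show "\<forall>y \<in> e. x[i := y ! i] = y"
      using x i by (auto intro!: nth_equalityI simp: e cube_verts_def nth_list_update)
    show "\<forall>a \<in> {..<k}. x[i := a] ! i = a"
      using x i by (simp add: cube_verts_def)
    show "(\<lambda>x. x ! i) ` e \<subseteq> {..<k}" using i by (auto simp: e cube_verts_nth)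
    show "(\<lambda>a. x[i := a]) ` {..<k} \<subseteq> e"
      using x by (auto simp: e cube_verts_update)
  qed
  then show ?thesis using that[OF i] by (simp add: e)
qed

lemma card_coordinate_diff_triangle:
  fixes x y z :: "nat \<Rightarrow> nat"
  shows "card {i. i < n \<and> x i \<noteq> z i} \<le>
    card {i. i < n \<and> x i \<noteq> y i} + card {i. i < n \<and> y i \<noteq> z i}"
proof -
  have "card {i. i < n \<and> x i \<noteq> z i} \<le> card ({i. i < n \<and> x i \<noteq> y i} \<union> {i. i < n \<and> y i \<noteq> z i})"
    by (rule card_mono) auto
  also have "\<dots> \<le> card {i. i < n \<and> x i \<noteq> y i} + card {i. i < n \<and> y i \<noteq> z i}"
    by (rule card_Un_le)
  finally show ?thesis .
qed

text \<open>Each step changes at most one coordinate, so by the triangle inequality the Hamming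
  distance from \<open>x\<close> grows by at most one per step.\<close>

lemma relpow_cube_lower:
  assumes "(x, y) \<in> adj (cube k n) ^^ m"
  shows "card {i. i < n \<and> x ! i \<noteq> y ! i} \<le> m"
  using assms
proof (induction m arbitrary: y)
  case (Suc m)
  then obtain w where w: "(x, w) \<in> adj (cube k n) ^^ m" "(w, y) \<in> adj (cube k n)" by auto
  then obtain e where e: "e \<in> edges (cube k n)" "w \<in> e" "y \<in> e" by (auto simp: adj_def)
  from e(1) obtain i where
    "\<And>x y j. x \<in> e \<Longrightarrow> y \<in> e \<Longrightarrow> j < n \<Longrightarrow> j \<noteq> i \<Longrightarrow> x ! j = y ! j"
    by (rule cube_edgeE) blast
  with e have "{j. j < n \<and> w ! j \<noteq> y ! j} \<subseteq> {i}" by blast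
  then have "card {j. j < n \<and> w ! j \<noteq> y ! j} \<le> 1"
    using card_mono[of "{i}"] by force
  then show ?case
    using Suc.IH[OF w(1)] card_coordinate_diff_triangle[of n "(!) x" "(!) y" "(!) w"] by linarith
qed simp

text \<open>Differing coordinates are corrected one at a time, and every intermediate tuple is again
  a vertex of the cube.\<close>

lemma relpow_cube_upper:
  assumes "x \<in> cube_verts k n" "y \<in> cube_verts k n"
  shows "(x, y) \<in> adj (cube k n) ^^ card {i. i < n \<and> x ! i \<noteq> y ! i}"
  using assms
proof (induction m \<equiv> "card {i. i < n \<and> x ! i \<noteq> y ! i}" arbitrary: x)
  case 0
  then have "x ! i = y ! i" if "i < n" for i using that by auto
  then have "x = y" using 0 by (auto simp: cube_verts_def intro: nth_equalityI)
  then show ?case by (simp flip: 0(1))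
next
  case (Suc m)
  then have "{i. i < n \<and> x ! i \<noteq> y ! i} \<noteq> {}" by (metis card.empty nat.distinct(1))
  then obtain i where i: "i < n" "x ! i \<noteq> y ! i" by blast
  let ?x = "x[i := y ! i]"
  have x': "?x \<in> cube_verts k n" using Suc.prems i by (simp add: cube_verts_update cube_verts_nth)
  have len: "length x = n" using Suc.prems by (simp add: cube_verts_def)
  have "{j. j < n \<and> ?x ! j \<noteq> y ! j} = {j. j < n \<and> x ! j \<noteq> y ! j} - {i}"
    using len i(1) by (auto simp: nth_list_update)
  then have "m = card {j. j < n \<and> ?x ! j \<noteq> y ! j}" using Suc(2) i by simp
  then have "(?x, y) \<in> adj (cube k n) ^^ m" using Suc.hyps(1)[of ?x] x' Suc.prems by metis
  moreover have "(x, ?x) \<in> adj (cube k n)"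
    unfolding adj_def cube_def using i(1) x' Suc.prems(1)
    by (auto intro!: exI[of _ "{z \<in> cube_verts k n. \<forall>j < n. j \<noteq> i \<longrightarrow> z ! j = x ! j}"])
  ultimately show ?case by (metis Suc(2) relpow_Suc_I2)
qed

lemma hdist_cube:
  assumes "x \<in> cube_verts k n" "y \<in> cube_verts k n"
  shows "hdist (cube k n) x y = enat (card {i. i < n \<and> x ! i \<noteq> y ! i})"
proof (rule enat_eqI_le)
  fix m
  show "hdist (cube k n) x y \<le> enat m \<longleftrightarrow> enat (card {i. i < n \<and> x ! i \<noteq> y ! i}) \<le> enat m"
    using relpow_cube_lower[of x y _ k n] relpow_cube_upper[OF assms]
    by (auto simp: hdist_le_iff[OF hypergraph_cube] intro: order_trans)
qed

section \<open>Counting separated pairs\<close>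

text \<open>The pairs are grouped by their image \<open>Q = {a, b}\<close>; a pair over
  \<open>Q\<close> is a choice of one element from each of the two fibres.\<close>

lemma card_separated_pairs:
  fixes g :: "'a \<Rightarrow> 'b"
  assumes fin: "finite V"
  shows "card {P. P \<subseteq> V \<and> card P = 2 \<and> card (g ` P) = 2} =
    (\<Sum>Q | Q \<subseteq> g ` V \<and> card Q = 2. \<Prod>q \<in> Q. card {v \<in> V. g v = q})"
proof -
  let ?Q = "{Q. Q \<subseteq> g ` V \<and> card Q = 2}"
  let ?S = "\<lambda>Q. {P. P \<subseteq> V \<and> card P = 2 \<and> g ` P = Q}"
  have finQ: "finite ?Q" using fin by (intro finite_subset[of ?Q "Pow (g ` V)"]) auto
  have finS: "finite (?S Q)" for Q using fin by (intro finite_subset[of "?S Q" "Pow V"]) auto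
  have fibre: "card (?S Q) = (\<Prod>q \<in> Q. card {v \<in> V. g v = q})" if "card Q = 2" for Q
  proof -
    from that obtain a b where ab: "Q = {a, b}" "a \<noteq> b" by (auto simp: card_2_iff)
    let ?A = "{v \<in> V. g v = a}" and ?B = "{v \<in> V. g v = b}"
    \<comment> \<open>As \<open>a \<noteq> b\<close>, each pair over \<open>Q\<close> has exactly
      one ordering whose first entry lies over \<open>a\<close>.\<close>
    have "bij_betw (\<lambda>(x, y). {x, y}) (?A \<times> ?B) (?S Q)"
      unfolding bij_betw_def
    proof (intro conjI equalityI subsetI)
      show "inj_on (\<lambda>(x, y). {x, y}) (?A \<times> ?B)"
        using ab(2) by (auto simp: inj_on_def doubleton_eq_iff)
      show "P \<in> ?S Q" if "P \<in> (\<lambda>(x, y). {x, y}) ` (?A \<times> ?B)" for P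
        using that ab by (auto simp: card_2_iff)
      fix P assume P: "P \<in> ?S Q"
      then obtain x y where xy: "P = {x, y}" "x \<in> V" "y \<in> V" by (auto simp: card_2_iff)
      with P ab have "g x = a \<and> g y = b \<or> g x = b \<and> g y = a" by (auto simp: doubleton_eq_iff)
      then show "P \<in> (\<lambda>(x, y). {x, y}) ` (?A \<times> ?B)"
      proof
        assume "g x = a \<and> g y = b"
        with xy show ?thesis by (intro image_eqI[of _ _ "(x, y)"]) auto
      next
        assume "g x = b \<and> g y = a"
        with xy show ?thesis by (intro image_eqI[of _ _ "(y, x)"]) auto
      qed
    qed
    then have "card (?S Q) = card (?A \<times> ?B)" by (simp add: bij_betw_same_card)
    with ab show ?thesis by (simp add: card_cartesian_product)
  qed
  have "{P. P \<subseteq> V \<and> card P = 2 \<and> card (g ` P) = 2} = (\<Union>Q \<in> ?Q. ?S Q)"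
    by auto (metis image_eqI subsetD)
  also have "card \<dots> = (\<Sum>Q \<in> ?Q. card (?S Q))"
    using finQ finS by (intro card_UN_disjoint) auto
  also have "\<dots> = (\<Sum>Q \<in> ?Q. \<Prod>q \<in> Q. card {v \<in> V. g v = q})"
    using fibre by (intro sum.cong) auto
  finally show ?thesis .
qed

section \<open>Hypergraphs with Hamming coordinates\<close>

text \<open>\<open>c v i\<close> is the \<open>i\<close>-th coordinate of the vertex \<open>v\<close>, and \<open>d e\<close> is the coordinate that varies
  along the edge \<open>e\<close>.\<close>

locale hamming_coordinates =
  fixes H :: "'a hypergraph" and k n :: nat and c :: "'a \<Rightarrow> nat \<Rightarrow> nat" and d :: "'a set \<Rightarrow> nat"
  assumes k2: "k \<ge> 2"
    and hyp: "hypergraph H"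
    and fin: "finite (verts H)"
    and coord_less: "v \<in> verts H \<Longrightarrow> i < n \<Longrightarrow> c v i < k"
    and dir_less: "e \<in> edges H \<Longrightarrow> d e < n"
    and edge_const: "e \<in> edges H \<Longrightarrow> u \<in> e \<Longrightarrow> v \<in> e \<Longrightarrow> j < n \<Longrightarrow> j \<noteq> d e \<Longrightarrow> c u j = c v j"
    and edge_bij: "e \<in> edges H \<Longrightarrow> bij_betw (\<lambda>v. c v (d e)) e {..<k}"
    and hdist_coord: "u \<in> verts H \<Longrightarrow> v \<in> verts H \<Longrightarrow>
      hdist H u v = enat (card {i. i < n \<and> c u i \<noteq> c v i})"
begin

section \<open>Half-spaces of an edge and the relation \<Theta>\<close>

lemma edge_verts: "e \<in> edges H \<Longrightarrow> v \<in> e \<Longrightarrow> v \<in> verts H"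
  using hyp by (auto simp: hypergraph_def)

lemma edge_inj: "e \<in> edges H \<Longrightarrow> u \<in> e \<Longrightarrow> v \<in> e \<Longrightarrow> c u (d e) = c v (d e) \<Longrightarrow> u = v"
  using edge_bij by (auto simp: bij_betw_def inj_on_def)

lemma edge_ex:
  assumes "e \<in> edges H" "q < k"
  shows "\<exists>v \<in> e. c v (d e) = q"
proof -
  have "q \<in> (\<lambda>v. c v (d e)) ` e" using assms edge_bij by (simp add: bij_betw_def)
  then show ?thesis by auto
qed

text \<open>Distances from \<open>z\<close> to the vertices of \<open>e\<close> differ only through
  coordinate \<open>d e\<close>. Exactly one vertex of \<open>e\<close> shares the value of
  \<open>z\<close> there, and it is nearer by one than all the others.\<close>

lemma closer_eq:
  assumes e: "e \<in> edges H" and a: "a \<in> e"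
  shows "closer H a e = {z \<in> verts H. c z (d e) = c a (d e)}"
proof -
  have "(\<forall>b \<in> e - {a}. hdist H z a < hdist H z b) \<longleftrightarrow> c z (d e) = c a (d e)"
    if z: "z \<in> verts H" for z
  proof -
    \<comment> \<open>The coordinates other than \<open>d e\<close> are constant on
      \<open>e\<close>, so this set is the same with any vertex of \<open>e\<close> in place of
      \<open>a\<close>.\<close>
    let ?K = "{i. i < n \<and> i \<noteq> d e \<and> c z i \<noteq> c a i}"
    have diff: "{i. i < n \<and> c z i \<noteq> c b i} = (if c z (d e) = c b (d e) then ?K else insert (d e) ?K)"
      if "b \<in> e" for b
      using edge_const[OF e that a] dir_less[OF e] by (auto, metis)
    have dist: "hdist H z b = enat (if c z (d e) = c b (d e) then card ?K else Suc (card ?K))"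
      if "b \<in> e" for b
      using hdist_coord[OF z edge_verts[OF e that]] diff[OF that] by simp
    show ?thesis
    proof
      assume near: "\<forall>b \<in> e - {a}. hdist H z a < hdist H z b"
      obtain b where b: "b \<in> e" "c b (d e) = c z (d e)"
        using edge_ex[OF e coord_less[OF z dir_less[OF e]]] by blast
      show "c z (d e) = c a (d e)"
      proof (rule ccontr)
        assume "c z (d e) \<noteq> c a (d e)"
        with near b dist[OF a] dist[OF b(1)] show False by force
      qed
    next
      assume eq: "c z (d e) = c a (d e)"
      show "\<forall>b \<in> e - {a}. hdist H z a < hdist H z b"
      proof
        fix b assume b: "b \<in> e - {a}"
        then have "c z (d e) \<noteq> c b (d e)" using edge_inj[OF e a, of b] eq by auto
        then show "hdist H z a < hdist H z b" using dist[OF a] dist[of b] b eq by simp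
      qed
    qed
  qed
  then show ?thesis by (auto simp: closer_def)
qed

text \<open>By \<open>closer_eq\<close>, \<open>e'\<close> meets all half-spaces of \<open>e\<close>
  iff coordinate \<open>d e\<close> takes every value on \<open>e'\<close>. It does so if it is the
  direction of \<open>e'\<close>, and is constant on \<open>e'\<close> otherwise.\<close>

lemma Theta_iff: "(e, e') \<in> Theta H \<longleftrightarrow> e \<in> edges H \<and> e' \<in> edges H \<and> d e = d e'"
proof -
  have "(\<forall>a \<in> e. e' \<inter> closer H a e \<noteq> {}) \<longleftrightarrow> d e = d e'" if e: "e \<in> edges H" "e' \<in> edges H"
  proof
    assume meet: "\<forall>a \<in> e. e' \<inter> closer H a e \<noteq> {}"
    \<comment> \<open>Two distinct values suffice to show that coordinate \<open>d e\<close> varies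
      on \<open>e'\<close>; 0 and 1 exist because \<open>k \<ge> 2\<close>.\<close>
    obtain a where a: "a \<in> e" "c a (d e) = 0" using edge_ex[OF e(1), of 0] k2 by force
    obtain b where b: "b \<in> e" "c b (d e) = 1" using edge_ex[OF e(1), of 1] k2 by force
    obtain x where x: "x \<in> e'" "c x (d e) = 0"
      using bspec[OF meet a(1)] a(2) unfolding closer_eq[OF e(1) a(1)] by auto
    obtain y where y: "y \<in> e'" "c y (d e) = 1"
      using bspec[OF meet b(1)] b(2) unfolding closer_eq[OF e(1) b(1)] by auto
    show "d e = d e'" using edge_const[OF e(2) x(1) y(1) dir_less[OF e(1)]] x(2) y(2) by auto
  next
    assume eq: "d e = d e'"
    show "\<forall>a \<in> e. e' \<inter> closer H a e \<noteq> {}"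
    proof
      fix a assume a: "a \<in> e"
      have "c a (d e) < k" using coord_less edge_verts[OF e(1) a] dir_less[OF e(1)] by blast
      then obtain z where "z \<in> e'" "c z (d e) = c a (d e)" using edge_ex[OF e(2)] eq by metis
      then show "e' \<inter> closer H a e \<noteq> {}"
        using closer_eq[OF e(1) a] edge_verts[OF e(2)] by auto
    qed
  qed
  then show ?thesis by (simp add: Theta_def conj_assoc setcompr_eq_image cong: conj_cong)
qed

text \<open>This set is a class of \<Theta> only for a direction that occurs; for any other
  \<open>i\<close> it is empty.\<close>

definition dclass :: "nat \<Rightarrow> 'a set set" where
  "dclass i = {e \<in> edges H. d e = i}"

lemma quotient_Theta: "edges H // Theta H = dclass ` d ` edges H"
proof -
  have "Theta H `` {e} = dclass (d e)" if "e \<in> edges H" for e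
    using that by (auto simp: dclass_def Theta_iff)
  then show ?thesis by (auto simp: quotient_def)
qed

lemma inj_dclass: "inj_on dclass (d ` edges H)"
  by (rule inj_onI) (auto simp: dclass_def)

section \<open>Components after deletion of a class\<close>

lemma hypergraph_delete: "hypergraph (delete_edges H F)"
  using hyp by (auto simp: hypergraph_def delete_edges_def)

lemma adj_delete_iff:
  "(u, v) \<in> adj (delete_edges H (dclass i)) \<longleftrightarrow> (\<exists>e \<in> edges H. d e \<noteq> i \<and> u \<in> e \<and> v \<in> e)"
  by (auto simp: adj_def delete_edges_def dclass_def)

text \<open>Every remaining edge has a direction other than \<open>i\<close>, so coordinate
  \<open>i\<close> is constant along it.\<close>

lemma connected_imp_coord_eq:
  assumes i: "i < n" and conn: "(u, v) \<in> (adj (delete_edges H (dclass i)))\<^sup>*"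
  shows "c u i = c v i"
  using conn
proof induction
  case (step v w)
  then obtain e where "e \<in> edges H" "d e \<noteq> i" "v \<in> e" "w \<in> e" by (auto simp: adj_delete_iff)
  then have "c v i = c w i" using edge_const i by metis
  with step.IH show ?case by simp
qed simp

text \<open>Induction on the Hamming distance to \<open>v\<close>: the first step of a geodesic
  decreases it, which a step in direction \<open>i\<close> cannot do, so that step survives the
  deletion.\<close>

lemma coord_eq_imp_connected:
  assumes "i < n" "u \<in> verts H" "v \<in> verts H" "c u i = c v i"
  shows "(u, v) \<in> (adj (delete_edges H (dclass i)))\<^sup>*"
  using assms
proof (induction m \<equiv> "card {i. i < n \<and> c u i \<noteq> c v i}" arbitrary: u rule: less_induct)
  case (less u)
  let ?m = "\<lambda>w. card {i. i < n \<and> c w i \<noteq> c v i}"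
  \<comment> \<open>The walk is no longer than the Hamming distance, so its first step must lead
    closer to \<open>v\<close>.\<close>
  obtain s where s: "s \<le> ?m u" "(u, v) \<in> adj H ^^ s"
    using hdist_le_iff[OF hyp, of u v "?m u"] hdist_coord less.prems by auto
  show ?case
  proof (cases s)
    case 0
    then show ?thesis using s by simp
  next
    case (Suc t)
    then obtain w where "(u, w) \<in> adj H" and wv: "(w, v) \<in> adj H ^^ t"
      using s(2) by (metis relpow_Suc_D2)
    then obtain e where e: "e \<in> edges H" "u \<in> e" "w \<in> e" by (auto simp: adj_def)
    have w: "w \<in> verts H" using edge_verts e by blast
    have "hdist H w v \<le> enat t" using wv hdist_le_iff[OF hyp] by blast
    then have lt: "?m w < ?m u" using hdist_coord[OF w less.prems(3)] s(1) Suc by simp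
    have "d e \<noteq> i"
    proof
      assume de: "d e = i"
      \<comment> \<open>Such a step fixes all other coordinates, and \<open>u\<close> already agrees
        with \<open>v\<close> in the deleted direction, so no difference disappears.\<close>
      then have "{i. i < n \<and> c u i \<noteq> c v i} \<subseteq> {i. i < n \<and> c w i \<noteq> c v i}"
        using edge_const[OF e] less.prems(4) by (auto, metis)
      then have "?m u \<le> ?m w" by (intro card_mono) auto
      with lt show False by simp
    qed
    then have uw: "(u, w) \<in> adj (delete_edges H (dclass i))" and "c u i = c w i"
      using e edge_const[OF e] less.prems(1) by (auto simp: adj_delete_iff)
    then have "(w, v) \<in> (adj (delete_edges H (dclass i)))\<^sup>*"
      using less.hyps[OF lt] less.prems w by simp
    with uw show ?thesis by (rule converse_rtrancl_into_rtrancl)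
  qed
qed

text \<open>The edge set is built as in \<open>component_of\<close>, so that components equal levels
  as hypergraphs and not only in their vertices.\<close>

definition level :: "nat \<Rightarrow> nat \<Rightarrow> 'a hypergraph" where
  "level i q = (let C = {v \<in> verts H. c v i = q}
    in Hypergraph C {e \<in> edges H - dclass i. e \<subseteq> C})"

lemma verts_level: "verts (level i q) = {v \<in> verts H. c v i = q}"
  by (simp add: level_def Let_def)

lemma component_of_eq_level:
  assumes "i < n" "u \<in> verts H"
  shows "component_of (delete_edges H (dclass i)) u = level i (c u i)"
proof -
  have "{v \<in> verts H. (u, v) \<in> (adj (delete_edges H (dclass i)))\<^sup>*} = {v \<in> verts H. c v i = c u i}"
    using coord_eq_imp_connected[OF assms] connected_imp_coord_eq[OF assms(1)] by metis
  then show ?thesis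
    unfolding component_of_def ex_is_path_iff[OF hypergraph_delete]
    by (simp add: level_def delete_edges_def)
qed

lemma component_of_eq_iff:
  assumes "i < n" "u \<in> verts H" "v \<in> verts H"
  shows "component_of (delete_edges H (dclass i)) u = component_of (delete_edges H (dclass i)) v
    \<longleftrightarrow> c u i = c v i"
proof -
  \<comment> \<open>A nonempty level determines its value \<open>q\<close>.\<close>
  have "u \<in> verts (level i (c u i))" using assms(2) by (simp add: verts_level)
  then have "c u i = c v i" if "level i (c u i) = level i (c v i)"
    unfolding that by (simp add: verts_level)
  then show ?thesis using assms by (auto simp: component_of_eq_level)
qed

text \<open>Presents the vertices of a component as a fibre of the component map, the form in which
  \<open>card_separated_pairs\<close> counts them.\<close>

lemma verts_component_of:
  assumes "i < n" "u \<in> verts H"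
  shows "verts (component_of (delete_edges H (dclass i)) u) =
    {v \<in> verts H. component_of (delete_edges H (dclass i)) v =
      component_of (delete_edges H (dclass i)) u}"
  using assms by (auto simp: component_of_eq_iff) (auto simp: component_of_eq_level verts_level)

lemma components_delete:
  "components (delete_edges H F) = component_of (delete_edges H F) ` verts H"
  by (simp add: components_def delete_edges_def)

text \<open>An edge of direction \<open>i\<close> already attains all \<open>k\<close> values of
  that coordinate, so the components are \<open>k\<close> nonempty and hence distinct
  levels.\<close>

lemma card_components:
  assumes i: "i \<in> d ` edges H"
  shows "card (components (delete_edges H (dclass i))) = k"
proof -
  from i obtain e where e: "e \<in> edges H" "d e = i" by auto
  have i_less: "i < n" using e dir_less by blast
  have surj: "(\<lambda>v. c v i) ` verts H = {..<k}"
    using edge_ex[OF e(1)] edge_verts[OF e(1)] e(2) coord_less i_less by fastforce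
  have "components (delete_edges H (dclass i)) = level i ` (\<lambda>v. c v i) ` verts H"
    unfolding components_delete image_image
    using component_of_eq_level[OF i_less] by (intro image_cong) auto
  then have eq: "components (delete_edges H (dclass i)) = level i ` {..<k}" by (simp add: surj)
  have "inj_on (level i) {..<k}"
  proof (rule inj_onI)
    fix p q assume p: "p \<in> {..<k}" and pq: "level i p = level i q"
    have "p \<in> (\<lambda>v. c v i) ` verts H" using p by (simp only: surj)
    then obtain v where v: "v \<in> verts H" "c v i = p" by auto
    then have "v \<in> verts (level i p)" by (simp add: verts_level)
    with v(2) show "p = q" unfolding pq by (simp add: verts_level)
  qed
  with eq show ?thesis by (simp add: card_image)
qed

section \<open>Distances and the Wiener index as counts of separations\<close>

text \<open>The coordinates in which \<open>u\<close> and \<open>v\<close> differ correspond under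
  \<open>dclass\<close> to the classes that separate them.\<close>

lemma hdist_eq_card_separating:
  assumes u: "u \<in> verts H" and v: "v \<in> verts H"
  shows "hdist H u v = enat (card {F \<in> edges H // Theta H.
    component_of (delete_edges H F) u \<noteq> component_of (delete_edges H F) v})"
proof -
  \<comment> \<open>If no edge had direction \<open>i\<close>, the deletion would change nothing;
    \<open>u\<close> and \<open>v\<close>, at finite distance in \<open>H\<close>, would stay
    connected and agree at \<open>i\<close>.\<close>
  have used: "i \<in> d ` edges H" if i: "i < n" "c u i \<noteq> c v i" for i
  proof (rule ccontr)
    assume "i \<notin> d ` edges H"
    then have "dclass i = {}" by (auto simp: dclass_def)
    then have "delete_edges H (dclass i) = H" by (simp add: delete_edges_def)
    moreover have "hdist H u v \<le> enat (card {i. i < n \<and> c u i \<noteq> c v i})"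
      using hdist_coord[OF u v] by simp
    then have "(u, v) \<in> (adj H)\<^sup>*"
      unfolding hdist_le_iff[OF hyp] by (auto intro: relpow_imp_rtrancl)
    ultimately have "(u, v) \<in> (adj (delete_edges H (dclass i)))\<^sup>*" by simp
    then show False using connected_imp_coord_eq[OF i(1)] i(2) by blast
  qed
  have less: "i < n" if "i \<in> d ` edges H" for i using that dir_less by auto
  have "{F \<in> edges H // Theta H.
      component_of (delete_edges H F) u \<noteq> component_of (delete_edges H F) v} =
    dclass ` {i. i < n \<and> c u i \<noteq> c v i}"
    unfolding quotient_Theta using component_of_eq_iff[OF _ u v] used less by auto
  moreover have "inj_on dclass {i. i < n \<and> c u i \<noteq> c v i}"
    using inj_dclass by (rule inj_on_subset) (use used in auto)
  ultimately show ?thesis using hdist_coord[OF u v] by (simp add: card_image)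
qed

text \<open>Double counting of the \<open>P\<close> and \<open>F\<close> such that deleting
  \<open>F\<close> separates the two vertices of \<open>P\<close>: a fixed \<open>P\<close>
  contributes its distance, a fixed \<open>F\<close> the products of component sizes.\<close>

lemma wiener_eq:
  "wiener H = enat (\<Sum>F \<in> edges H // Theta H.
     \<Sum>P | P \<subseteq> components (delete_edges H F) \<and> card P = 2. \<Prod>C \<in> P. card (verts C))"
proof -
  let ?P = "{P. P \<subseteq> verts H \<and> card P = 2}" and ?Q = "edges H // Theta H"
  let ?g = "\<lambda>F. component_of (delete_edges H F)"
  have finP: "finite ?P" using fin by (intro finite_subset[of ?P "Pow (verts H)"]) auto
  have "edges H \<subseteq> Pow (verts H)" using edge_verts by auto
  then have finE: "finite (edges H)" using fin by (meson finite_Pow_iff finite_subset)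
  then have finQ: "finite ?Q" by (simp add: quotient_Theta)
  have pair: "(THE d. \<exists>u v. P = {u, v} \<and> d = hdist H u v) =
      enat (card {F \<in> ?Q. card (?g F ` P) = 2})" if "P \<in> ?P" for P
  proof -
    from that obtain u v where P: "P = {u, v}" "u \<in> verts H" "v \<in> verts H"
      by (auto simp: card_2_iff)
    \<comment> \<open>Separation is expressed by the size of the image, to match
      \<open>card_separated_pairs\<close>.\<close>
    have "card (?g F ` P) = 2 \<longleftrightarrow> ?g F u \<noteq> ?g F v" for F
      using P by (auto simp: card_insert_if)
    then show ?thesis using hdist_eq_card_separating[OF P(2,3)] by (simp add: P(1) hdist_pair)
  qed
  have inner: "(\<Sum>P | P \<subseteq> components (delete_edges H F) \<and> card P = 2. \<Prod>C \<in> P. card (verts C)) =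
      card {P \<in> ?P. card (?g F ` P) = 2}" if "F \<in> ?Q" for F
  proof -
    from that obtain e where "e \<in> edges H" "F = dclass (d e)" by (auto simp: quotient_Theta)
    with dir_less obtain i where i: "i < n" "F = dclass i" by blast
    have "card (verts C) = card {v \<in> verts H. ?g F v = C}" if "C \<in> ?g F ` verts H" for C
      using that verts_component_of[OF i(1)] i(2) by auto
    then have "(\<Sum>P | P \<subseteq> ?g F ` verts H \<and> card P = 2. \<Prod>C \<in> P. card (verts C)) =
      (\<Sum>P | P \<subseteq> ?g F ` verts H \<and> card P = 2. \<Prod>C \<in> P. card {v \<in> verts H. ?g F v = C})"
      by (intro sum.cong prod.cong) auto
    also have "\<dots> = card {P \<in> ?P. card (?g F ` P) = 2}"
      using card_separated_pairs[OF fin, of "?g F"] by (simp add: conj_assoc)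
    finally show ?thesis by (simp add: components_delete)
  qed
  have "wiener H = (\<Sum>P \<in> ?P. enat (card {F \<in> ?Q. card (?g F ` P) = 2}))"
    unfolding wiener_def using pair by (intro sum.cong) auto
  \<comment> \<open>All distances are finite, so the sums can be interchanged over the natural
    numbers.\<close>
  also have "\<dots> = enat (\<Sum>P \<in> ?P. card {F \<in> ?Q. card (?g F ` P) = 2})"
    by (simp flip: of_nat_eq_enat)
  also have "(\<Sum>P \<in> ?P. card {F \<in> ?Q. card (?g F ` P) = 2}) =
      (\<Sum>F \<in> ?Q. card {P \<in> ?P. card (?g F ` P) = 2})"
    using sum_multicount_gen[OF finP finQ, of "\<lambda>P F. card (?g F ` P) = 2"] by simp
  also have "\<dots> = (\<Sum>F \<in> ?Q.
     \<Sum>P | P \<subseteq> components (delete_edges H F) \<and> card P = 2. \<Prod>C \<in> P. card (verts C))"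
    using inner by (intro sum.cong) auto
  finally show ?thesis .
qed

end

section \<open>Coordinates from an isometric embedding\<close>

text \<open>Coordinates are pulled back along the isomorphism \<open>f\<close>. Edges of
  \<open>H\<close> map to full lines of the cube, whose directions give \<open>d\<close>, and
  isometry turns distances into Hamming distances.\<close>

lemma partial_cube_hypergraph_coordinates:
  assumes "k \<ge> 2" and "partial_cube_hypergraph k H"
  obtains n c d where "hamming_coordinates H k n c d"
proof -
  from assms obtain n H' f where hyp: "hypergraph H"
    and iso: "isometric_subhypergraph H' (cube k n)"
    and bij: "bij_betw f (verts H) (verts H')" and ed: "edges H' = (\<lambda>e. f ` e) ` edges H"
    by (auto simp: partial_cube_hypergraph_def uniform_def isomorphic_def)
  have hyp': "hypergraph H'" and sub: "verts H' \<subseteq> cube_verts k n"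
    and esub: "edges H' \<subseteq> edges (cube k n)"
    and dist: "\<And>x y. x \<in> verts H' \<Longrightarrow> y \<in> verts H' \<Longrightarrow> hdist H' x y = hdist (cube k n) x y"
    using iso by (auto simp: isometric_subhypergraph_def subhypergraph_def cube_def)
  have f: "f v \<in> verts H'" if "v \<in> verts H" for v using bij that by (simp add: bij_betw_apply)
  have "\<exists>i < n. (\<forall>u \<in> e. \<forall>v \<in> e. \<forall>j < n. j \<noteq> i \<longrightarrow> f u ! j = f v ! j) \<and>
      bij_betw (\<lambda>v. f v ! i) e {..<k}" if e: "e \<in> edges H" for e
  proof -
    have "f ` e \<in> edges (cube k n)" using e ed esub by auto
    then obtain i where i: "i < n"
      "\<And>x y j. x \<in> f ` e \<Longrightarrow> y \<in> f ` e \<Longrightarrow> j < n \<Longrightarrow> j \<noteq> i \<Longrightarrow> x ! j = y ! j"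
      "bij_betw (\<lambda>x. x ! i) (f ` e) {..<k}"
      by (rule cube_edgeE) blast
    have "e \<subseteq> verts H" using e hyp by (auto simp: hypergraph_def)
    then have "bij_betw f e (f ` e)" using bij by (meson bij_betw_imageI bij_betw_imp_inj_on inj_on_subset)
    from bij_betw_trans[OF this i(3)] have "bij_betw (\<lambda>v. f v ! i) e {..<k}" by (simp add: comp_def)
    with i(1,2) show ?thesis by blast
  qed
  then obtain d where d: "\<And>e. e \<in> edges H \<Longrightarrow> d e < n \<and>
      (\<forall>u \<in> e. \<forall>v \<in> e. \<forall>j < n. j \<noteq> d e \<longrightarrow> f u ! j = f v ! j) \<and>
      bij_betw (\<lambda>v. f v ! d e) e {..<k}"
    by metis
  have "hamming_coordinates H k n (\<lambda>v i. f v ! i) d"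
  proof
    show "finite (verts H)"
      using bij_betw_finite[OF bij] finite_subset[OF sub finite_cube_verts] by blast
    show "f v ! i < k" if "v \<in> verts H" "i < n" for v i
      using f[OF that(1)] sub that(2) cube_verts_nth by blast
    show "hdist H u v = enat (card {i. i < n \<and> f u ! i \<noteq> f v ! i})"
      if "u \<in> verts H" "v \<in> verts H" for u v
      using hdist_isomorphism[OF hyp hyp' bij ed that] dist f that sub
        hdist_cube[of "f u" k n "f v"] by auto
  qed (use assms(1) hyp d in blast)+
  then show ?thesis by (rule that)
qed

theorem theorem3p3:
  fixes H :: "'a hypergraph" and k :: nat
  assumes "k \<ge> 2"
    and "partial_cube_hypergraph k H"
  shows "(\<forall>F \<in> edges H // Theta H. card (components (delete_edges H F)) = k) \<and>
         wiener H = enat (\<Sum>F \<in> edges H // Theta H.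
                            \<Sum>P | P \<subseteq> components (delete_edges H F) \<and> card P = 2.
                              \<Prod>C \<in> P. card (verts C))"
proof -
  from assms obtain n c d where "hamming_coordinates H k n c d"
    by (rule partial_cube_hypergraph_coordinates)
  then interpret hamming_coordinates H k n c d .
  show ?thesis using card_components wiener_eq by (auto simp: quotient_Theta)
qed

end
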